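(* Let $n \ge 2$ be an integer, and let $K, L \subset \mathbb{R}^2$ be compact convex sets with non-empty interior, both of which are $D_n$-symmetric (i.e. invariant under every element of the group $D_n$). Then the function $\mathbb{R} \to (0,\infty)$, $t \mapsto |e^t K \cap L|$, is log-concave; that is, for all $s, t \in \mathbb{R}$ and all $\lambda \in [0,1]$, $$ |e^{(1-\lambda)s + \lambda t} K \cap L| \ \ge\ |e^s K \cap L|^{1-\lambda}\, |e^t K \cap L|^{\lambda}. $$
   Context: $|\cdot|$ denotes Lebesgue measure (area) on $\mathbb{R}^2$. For $r > 0$ and $K \subset \mathbb{R}^2$, $rK = \{ r x : x \in K\}$. For an integer $n \ge 2$, $D_n$ is the group of linear isometries of $\mathbb{R}^2$ generated by two reflections: the reflection across the line $\mathrm{Span}\{(1,0)\}$ and the reflection across the line $\mathrm{Span}\{(\cos\frac{\pi}{n}, \sin\frac{\pi}{n})\}$. It has $2n$ elements. A set $A \subset \mathbb{R}^2$ is $D_n$-symmetric if $g(A) = A$ for every $g \in D_n$. *)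

theory Defs
  imports "HOL-Analysis.Analysis" "HOL-Algebra.Bij" "HOL-Algebra.Generated_Groups"
begin

text \<open>Orthogonal reflection of the plane across the line spanned by \<open>u \<noteq> 0\<close>:
  twice the orthogonal projection onto the line, minus the identity.\<close>

definition reflect_line :: "real^2 \<Rightarrow> real^2 \<Rightarrow> real^2" where
  "reflect_line u x = (2 * ((x \<bullet> u) / (u \<bullet> u))) *\<^sub>R u - x"

definition dihedral_generators :: "nat \<Rightarrow> (real^2 \<Rightarrow> real^2) set" where
  "dihedral_generators n =
     {reflect_line (vector [1, 0]), reflect_line (vector [cos (pi / n), sin (pi / n)])}"

text \<open>The ambient group is the group of all bijections of the plane under composition; the
  generators lie in it by \<open>dihedral_generators_Bij\<close>, and the elements of the
  generated subgroup are linear isometries by \<open>dihedral_orthogonal\<close>.\<close>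

definition dihedral :: "nat \<Rightarrow> (real^2 \<Rightarrow> real^2) set" where
  "dihedral n = generate (BijGroup UNIV) (dihedral_generators n)"

definition dihedral_symmetric :: "nat \<Rightarrow> (real^2) set \<Rightarrow> bool" where
  "dihedral_symmetric n A \<longleftrightarrow> (\<forall>g\<in>dihedral n. g ` A = A)"

lemma reflect_line_fixes_line: "reflect_line u (c *\<^sub>R u) = c *\<^sub>R u"
  by (cases "u = 0") (simp_all add: reflect_line_def flip: scaleR_left_diff_distrib)

lemma reflect_line_negates_normal: "x \<bullet> u = 0 \<Longrightarrow> reflect_line u x = - x"
  by (simp add: reflect_line_def)

lemma orthogonal_transformation_reflect_line:
  "orthogonal_transformation (reflect_line u)"
proof (cases "u = 0")
  case True
  then show ?thesis
    by (simp add: reflect_line_def orthogonal_transformation_def linear_iff)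
next
  case False
  then show ?thesis
    unfolding orthogonal_transformation_def linear_iff reflect_line_def
    by (auto simp: inner_diff_left inner_diff_right inner_add_left inner_add_right
        inner_commute field_simps simp flip: scaleR_add_left)
qed

lemma orthogonal_transformation_Bij:
  fixes f :: "real^2 \<Rightarrow> real^2"
  shows "orthogonal_transformation f \<Longrightarrow> f \<in> Bij UNIV"
  by (simp add: Bij_def orthogonal_transformation_bij)

lemma dihedral_generators_Bij: "dihedral_generators n \<subseteq> Bij UNIV"
  by (auto simp: dihedral_generators_def
      intro: orthogonal_transformation_Bij orthogonal_transformation_reflect_line)

lemma dihedral_orthogonal:
  assumes "g \<in> dihedral n"
  shows "orthogonal_transformation g"
  using assms unfolding dihedral_def
proof (induction rule: generate.induct)
  case one
  show ?case
    by (simp add: BijGroup_def orthogonal_transformation_def linear_iff)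
next
  case (incl h)
  then show ?case
    by (auto simp: dihedral_generators_def orthogonal_transformation_reflect_line)
next
  case (inv h)
  then have "orthogonal_transformation h"
    by (auto simp: dihedral_generators_def orthogonal_transformation_reflect_line)
  then show ?case
    using orthogonal_transformation_Bij[of h] orthogonal_transformation_inv[of h]
    by (simp add: inv_BijGroup)
next
  case (eng g h)
  have "g \<otimes>\<^bsub>BijGroup UNIV\<^esub> h = g \<circ> h"
    using eng.IH[THEN orthogonal_transformation_Bij]
    by (auto simp: BijGroup_def compose_def)
  then show ?case
    using orthogonal_transformation_compose[OF eng.IH] by (simp add: o_def)
qed

end

theory Submission
  imports Defs
begin

text \<open>
  The mirrors of the dihedral group cut the plane into \<open>2 n\<close> congruent sectors of angle
  \<open>\<delta> = \<pi> / n\<close>, and a symmetric set has \<open>2 n\<close> times the area of its part in one of them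
  (\<open>measure_eq_fundamental_sector\<close>). So everything can be computed in one sector, in the
  oblique coordinates \<open>(a, b)\<close> along its two edges, where the sector becomes the open quadrant and
  areas change by the constant factor \<open>sin \<delta>\<close> (\<open>cone_coords_regular\<close>).

  In these coordinates the part in the sector of a symmetric convex set \<open>K\<close> is convex, and it is
  also downward closed: since
  \<open>K\<close> contains the projections of its points to the mirrors and \<open>\<delta> \<le> \<pi> / 2\<close>, a coordinate can be
  decreased without leaving \<open>K\<close> (\<open>cone_coords_downward_closed\<close>). By the inequality of the
  arithmetic and geometric means, this part is then closed under coordinatewise weighted geometric means
  (\<open>cone_coords_geometric_mean\<close>). In other words, its image under
  \<open>(a, b) \<mapsto> (ln a, ln b)\<close> is convex.

  In logarithmic coordinates the dilation by \<open>e\<^sup>t\<close> is the translation by \<open>(t, t)\<close>. Hence if \<open>A t\<close>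
  denotes the coordinate set of \<open>e\<^sup>t K \<inter> L\<close>, the weighted geometric means of points of \<open>A s\<close> and
  \<open>A t\<close> lie in \<open>A ((1 - \<theta>) s + \<theta> t)\<close>, and the claim is an inequality of Prekopa--Leindler type for
  sets in the quadrant: the area of a set containing all weighted geometric means of points of two
  sets is at least the weighted geometric mean of their areas
  (\<open>measure_geometric_mean_set_ge\<close>). It follows by slicing from the one-dimensional
  Prekopa--Leindler inequality in logarithmic coordinates
  (\<open>prekopa_leindler_multiplicative\<close>), and that one from the Brunn--Minkowski inequality on the
  line applied to superlevel sets.
\<close>

section \<open>The Brunn--Minkowski inequality on the line\<close>

text \<open>The sumset contains a translate of \<open>A\<close> and a translate of \<open>B\<close>, taken so that
  the last point of the former is the first point of the latter; their lengths add up.\<close>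

lemma emeasure_sumset_compact_ge:
  fixes A B H :: "real set"
  assumes A: "compact A" "A \<noteq> {}" and B: "compact B" "B \<noteq> {}"
    and H: "H \<in> sets lebesgue" "\<And>a b. a \<in> A \<Longrightarrow> b \<in> B \<Longrightarrow> a + b \<in> H"
  shows "emeasure lebesgue A + emeasure lebesgue B \<le> emeasure lebesgue H"
proof -
  obtain a where a: "a \<in> A" "\<And>x. x \<in> A \<Longrightarrow> x \<le> a"
    using compact_attains_sup[OF A] by blast
  obtain b where b: "b \<in> B" "\<And>x. x \<in> B \<Longrightarrow> b \<le> x"
    using compact_attains_inf[OF B] by blast
  define A' where "A' = (\<lambda>x. 1 *\<^sub>R x + b) ` A"
  define B' where "B' = (\<lambda>x. 1 *\<^sub>R x + a) ` B"
  have cA: "compact A'" and cB: "compact B'"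
    unfolding A'_def B'_def using A B by (auto intro!: compact_continuous_image continuous_intros)
  then have sA: "A' \<in> sets lebesgue" and sB: "B' \<in> sets lebesgue"
    using lmeasurable_compact fmeasurableD by blast+
  \<comment> \<open>\<open>A'\<close> ends at \<open>a + b\<close>, where \<open>B'\<close> begins.\<close>
  have sub: "A' \<inter> B' \<subseteq> {a + b}"
  proof
    fix z assume "z \<in> A' \<inter> B'"
    then obtain x y where "x \<in> A" "y \<in> B" "z = x + b" "z = y + a"
      by (auto simp: A'_def B'_def)
    then show "z \<in> {a + b}"
      using a(2)[of x] b(2)[of y] by simp
  qed
  have null: "A' \<inter> B' \<in> null_sets lebesgue"
    using negligible_subset[OF _ sub] by (simp add: negligible_iff_null_sets)
  have "emeasure lebesgue A + emeasure lebesgue B = emeasure lebesgue A' + emeasure lebesgue B'"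
    unfolding A'_def B'_def emeasure_lebesgue_affine by simp
  also have "\<dots> = emeasure lebesgue (A' \<union> B')"
    using emeasure_Un'[OF sA sB null] by simp
  also have "\<dots> \<le> emeasure lebesgue H"
    using a b H by (intro emeasure_mono) (auto simp: A'_def B'_def add.commute[of _ a])
  finally show ?thesis .
qed

text \<open>Inner regularity for sets of arbitrary, possibly infinite, measure: approximate by
  closed sets from inside, and exhaust those by their bounded parts. Restricting to non-empty
  compact sets matters because a sumset with an empty summand is empty.\<close>

lemma emeasure_lebesgue_eq_SUP_compact:
  fixes A :: "'a::euclidean_space set"
  assumes A: "A \<in> sets lebesgue" "A \<noteq> {}"
  shows "emeasure lebesgue A = (SUP C\<in>{C. compact C \<and> C \<noteq> {} \<and> C \<subseteq> A}. emeasure lebesgue C)"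
    (is "_ = (SUP C\<in>?\<C>. _)")
proof (rule antisym)
  show "(SUP C\<in>?\<C>. emeasure lebesgue C) \<le> emeasure lebesgue A"
    by (rule SUP_least) (auto intro!: emeasure_mono A)
  show "emeasure lebesgue A \<le> (SUP C\<in>?\<C>. emeasure lebesgue C)"
  proof (rule dense_le)
    fix r assume r: "r < emeasure lebesgue A"
    then obtain r' where r': "r < r'" "r' < emeasure lebesgue A"
      using dense by blast
    then have fin: "r < \<infinity>" "r' < \<infinity>"
      using top.not_eq_extremum by fastforce+
    define e where "e = enn2real (r' - r)"
    have e: "ennreal e = r' - r" "e > 0"
      using r' fin by (auto simp: e_def enn2real_positive_iff diff_gr0_ennreal less_top[symmetric] intro: le_less_trans[OF diff_le_self_ennreal])
    obtain T where T: "closed T" "T \<subseteq> A" "A - T \<in> lmeasurable" "emeasure lebesgue (A - T) < ennreal e"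
      using sets_lebesgue_inner_closed[OF A(1) e(2)] by blast
    have sT: "T \<in> sets lebesgue"
      using T(1) by auto
    have "r < emeasure lebesgue T"
    proof (rule ccontr)
      assume "\<not> r < emeasure lebesgue T"
      then have "emeasure lebesgue T + emeasure lebesgue (A - T) \<le> r + ennreal e"
        using T(4) by (intro add_mono) auto
      moreover have "emeasure lebesgue A \<le> emeasure lebesgue T + emeasure lebesgue (A - T)"
        using emeasure_subadditive[of T lebesgue "A - T"] T sT
        by (simp add: Un_absorb1 fmeasurableD)
      ultimately have "emeasure lebesgue A \<le> r + ennreal e"
        by order
      also have "\<dots> = r'"
        using e r' by (simp add: add_diff_inverse_ennreal less_imp_le)
      finally show False
        using r'(2) by simp
    qed
    also have "emeasure lebesgue T = (SUP n::nat. emeasure lebesgue (T \<inter> cball 0 (real n)))"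
    proof -
      have "T = (\<Union>n::nat. T \<inter> cball 0 (real n))"
        using real_arch_simple by fastforce
      moreover have "incseq (\<lambda>n::nat. T \<inter> cball 0 (real n))"
        by (auto simp: incseq_def)
      ultimately show ?thesis
        using SUP_emeasure_incseq[of "\<lambda>n::nat. T \<inter> cball 0 (real n)" lebesgue] T(1)
        by (metis (no_types, lifting) borel_closed closed_Int closed_cball image_subsetI sets_completionI_sets sets_lborel)
    qed
    finally obtain n :: nat where n: "r < emeasure lebesgue (T \<inter> cball 0 (real n))"
      by (auto simp: less_SUP_iff)
    then have "T \<inter> cball 0 (real n) \<in> ?\<C>"
      using T by (auto intro: closed_Int_compact)
    then show "r \<le> (SUP C\<in>?\<C>. emeasure lebesgue C)"
      using n by (meson SUP_upper less_imp_le order_trans)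
  qed
qed

text \<open>The compact case passes to measurable sets by inner regularity; phrasing it with a set
  \<open>H\<close> that contains the sumset avoids the question whether the sumset is measurable.\<close>

lemma brunn_minkowski_real:
  fixes A B H :: "real set"
  assumes A: "A \<in> sets lebesgue" "A \<noteq> {}" and B: "B \<in> sets lebesgue" "B \<noteq> {}"
    and H: "H \<in> sets lebesgue" "\<And>a b. a \<in> A \<Longrightarrow> b \<in> B \<Longrightarrow> a + b \<in> H"
  shows "emeasure lebesgue A + emeasure lebesgue B \<le> emeasure lebesgue H"
proof -
  have ne: "{C. compact C \<and> C \<noteq> {} \<and> C \<subseteq> S} \<noteq> {}" if "S \<noteq> {}" for S :: "real set"
    using that by (auto intro!: exI[of _ "{SOME x. x \<in> S}"] simp: some_in_eq)
  have 1: "emeasure lebesgue A + emeasure lebesgue D \<le> emeasure lebesgue H"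
    if D: "compact D" "D \<noteq> {}" "D \<subseteq> B" for D
    unfolding emeasure_lebesgue_eq_SUP_compact[OF A]
    unfolding ennreal_SUP_add_left[symmetric, OF ne[OF A(2)]]
  proof (rule SUP_least)
    fix C assume "C \<in> {C. compact C \<and> C \<noteq> {} \<and> C \<subseteq> A}"
    then show "emeasure lebesgue C + emeasure lebesgue D \<le> emeasure lebesgue H"
      using D H by (intro emeasure_sumset_compact_ge) auto
  qed
  show ?thesis
    unfolding emeasure_lebesgue_eq_SUP_compact[OF B]
    unfolding ennreal_SUP_add_right[OF ne[OF B(2)]]
    by (rule SUP_least) (use 1 in auto)
qed

section \<open>The Prekopa--Leindler inequality on the line\<close>

lemma nn_integral_layer_cake:
  fixes f :: "'a::euclidean_space \<Rightarrow> real"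
  assumes [measurable]: "f \<in> borel_measurable borel"
  shows "(\<integral>\<^sup>+x. ennreal (f x) \<partial>lborel)
    = (\<integral>\<^sup>+l. indicator {0<..} l * emeasure lborel {x. l < f x} \<partial>(lborel :: real measure))"
proof -
  have 1: "ennreal (f x) = (\<integral>\<^sup>+l. indicator {p. 0 < snd p \<and> snd p < f (fst p)} (x, l) \<partial>lborel)" for x
  proof -
    have "(\<integral>\<^sup>+l. indicator {p. 0 < snd p \<and> snd p < f (fst p)} (x, l) \<partial>lborel)
        = (\<integral>\<^sup>+l. indicator {0<..<f x} l \<partial>(lborel :: real measure))"
      by (intro nn_integral_cong) (auto split: split_indicator)
    also have "\<dots> = ennreal (f x)"
      by (cases "0 \<le> f x") (auto simp: ennreal_neg)
    finally show ?thesis by simp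
  qed
  have 2: "(\<integral>\<^sup>+x. indicator {p. 0 < snd p \<and> snd p < f (fst p)} (x, l) \<partial>lborel)
      = indicator {0<..} l * emeasure lborel {x. l < f x}" for l :: real
  proof -
    have "(\<integral>\<^sup>+x. indicator {p. 0 < snd p \<and> snd p < f (fst p)} (x, l) \<partial>lborel)
        = (\<integral>\<^sup>+x. indicator {0<..} l * indicator {x. l < f x} x \<partial>lborel)"
      by (intro nn_integral_cong) (auto split: split_indicator)
    also have "\<dots> = indicator {0<..} l * emeasure lborel {x. l < f x}"
      by (subst nn_integral_cmult) auto
    finally show ?thesis .
  qed
  have m: "{p. 0 < snd p \<and> snd p < f (fst p)} \<in> sets (lborel \<Otimes>\<^sub>M (lborel :: real measure))"
  proof -
    have "{p \<in> space ((borel :: 'a measure) \<Otimes>\<^sub>M (borel :: real measure)). 0 < snd p \<and> snd p < f (fst p)}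
        \<in> sets (borel \<Otimes>\<^sub>M borel)"
      by measurable
    then show ?thesis
      by (simp add: space_pair_measure)
  qed
  show ?thesis
    unfolding 1 2[symmetric]
    by (rule lborel_pair.Fubini'[symmetric]) (use m in \<open>auto simp: case_prod_unfold\<close>)
qed

text \<open>When both suprema are \<open>1\<close>, the superlevel sets of \<open>f\<close> and \<open>g\<close> at any level
  below \<open>1\<close> are non-empty, so Brunn--Minkowski applies level by level; integrating over the
  levels even gives the arithmetic mean of the integrals as a lower bound. Above level \<open>1\<close>
  both superlevel sets are empty and there is nothing to show.\<close>

lemma prekopa_leindler_normalized:
  fixes f g h :: "real \<Rightarrow> real"
  assumes \<theta>: "0 < \<theta>" "\<theta> < 1"
    and int: "integrable lborel f" "integrable lborel g" "integrable lborel h"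
    and nonneg: "\<And>x. 0 \<le> f x" "\<And>x. 0 \<le> g x" "\<And>x. 0 \<le> h x"
    and f1: "\<And>x. f x \<le> 1" "\<And>l. l < 1 \<Longrightarrow> \<exists>x. l < f x"
    and g1: "\<And>x. g x \<le> 1" "\<And>l. l < 1 \<Longrightarrow> \<exists>x. l < g x"
    and h: "\<And>x y. f x powr (1 - \<theta>) * g y powr \<theta> \<le> h ((1 - \<theta>) * x + \<theta> * y)"
  shows "(1 - \<theta>) * (\<integral>x. f x \<partial>lborel) + \<theta> * (\<integral>x. g x \<partial>lborel) \<le> (\<integral>x. h x \<partial>lborel)"
proof -
  have [measurable]: "f \<in> borel_measurable borel" "g \<in> borel_measurable borel" "h \<in> borel_measurable borel"
    using int by (auto dest: borel_measurable_integrable)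
  have level: "ennreal (1 - \<theta>) * (indicator {0<..} l * emeasure lborel {x. l < f x})
      + ennreal \<theta> * (indicator {0<..} l * emeasure lborel {x. l < g x})
      \<le> indicator {0<..} l * emeasure lborel {x. l < h x}" for l :: real
  proof (cases "0 < l \<and> l < 1")
    case False
    have "{x. l < f x} = {}" "{x. l < g x} = {}" if "l > 0"
      using False that f1(1) g1(1) by (auto simp: not_less intro: order_trans)
    then show ?thesis by (auto split: split_indicator)
  next
    case True
    define A where "A = (\<lambda>x. (1 - \<theta>) *\<^sub>R x + 0) ` {x. l < f x}"
    define B where "B = (\<lambda>x. \<theta> *\<^sub>R x + 0) ` {x. l < g x}"
    have scale: "(\<lambda>x. c *\<^sub>R x + 0) ` S = (\<lambda>x. x / c) -` S" if "0 < c" for c :: real and S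
    proof (intro equalityI subsetI)
      fix x assume "x \<in> (\<lambda>x. x / c) -` S"
      then show "x \<in> (\<lambda>x. c *\<^sub>R x + 0) ` S"
        using that by (intro image_eqI[of _ _ "x / c"]) simp_all
    qed (use that in auto)
    have eA: "A = (\<lambda>x. x / (1 - \<theta>)) -` {x. l < f x}" and eB: "B = (\<lambda>x. x / \<theta>) -` {x. l < g x}"
      unfolding A_def B_def using \<theta> by (simp_all only: scale diff_gt_0_iff_gt)
    have [measurable]: "A \<in> sets borel" "B \<in> sets borel"
      unfolding eA eB by (rule measurable_sets_borel; measurable)+
    have "emeasure lebesgue A + emeasure lebesgue B \<le> emeasure lebesgue {x. l < h x}"
    proof (rule brunn_minkowski_real)
      fix a b assume "a \<in> A" "b \<in> B"
      then obtain x y where xy: "l < f x" "l < g y" "a = (1 - \<theta>) * x" "b = \<theta> * y"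
        by (auto simp: A_def B_def)
      \<comment> \<open>Both factors exceed the powers of the common level, whose exponents sum to \<open>1\<close>.\<close>
      have "l = l powr (1 - \<theta>) * l powr \<theta>"
        using True by (simp flip: powr_add)
      also have "\<dots> < f x powr (1 - \<theta>) * g y powr \<theta>"
        using xy \<theta> True by (intro mult_strict_mono powr_less_mono2) auto
      also have "\<dots> \<le> h (a + b)"
        using h xy by simp
      finally show "a + b \<in> {x. l < h x}" by simp
    next
      show "A \<in> sets lebesgue" "B \<in> sets lebesgue" "{x. l < h x} \<in> sets lebesgue"
        by (simp_all add: sets_completionI_sets)
      show "A \<noteq> {}" "B \<noteq> {}"
        using f1(2)[of l] g1(2)[of l] True by (auto simp: A_def B_def)
    qed
    moreover have "emeasure lebesgue A = ennreal (1 - \<theta>) * emeasure lborel {x. l < f x}"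
      "emeasure lebesgue B = ennreal \<theta> * emeasure lborel {x. l < g x}"
      unfolding A_def B_def emeasure_lebesgue_affine using \<theta> by simp_all
    ultimately show ?thesis
      using True by simp
  qed
  have "ennreal ((1 - \<theta>) * (\<integral>x. f x \<partial>lborel) + \<theta> * (\<integral>x. g x \<partial>lborel))
      = ennreal (1 - \<theta>) * (\<integral>\<^sup>+x. f x \<partial>lborel) + ennreal \<theta> * (\<integral>\<^sup>+x. g x \<partial>lborel)"
    using \<theta> int nonneg by (simp add: nn_integral_eq_integral ennreal_plus ennreal_mult)
  also have "\<dots> = (\<integral>\<^sup>+l. ennreal (1 - \<theta>) * (indicator {0<..} l * emeasure lborel {x. l < f x})
      + ennreal \<theta> * (indicator {0<..} l * emeasure lborel {x. l < g x}) \<partial>(lborel :: real measure))"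
    by (subst nn_integral_add) (auto simp: nn_integral_cmult nn_integral_layer_cake)
  also have "\<dots> \<le> (\<integral>\<^sup>+l. indicator {0<..} l * emeasure lborel {x. l < h x} \<partial>(lborel :: real measure))"
    by (intro nn_integral_mono level)
  also have "\<dots> = ennreal (\<integral>x. h x \<partial>lborel)"
    using int nonneg by (simp add: nn_integral_layer_cake[symmetric] nn_integral_eq_integral)
  finally show ?thesis
    using nonneg by (subst (asm) ennreal_le_iff) (auto intro: integral_nonneg)
qed

text \<open>Rescaling \<open>f\<close> and \<open>g\<close> to supremum \<open>1\<close> reduces to the normalized case, where
  Young's inequality turns the arithmetic mean into the geometric one. The geometric mean, unlike the
  arithmetic one, is homogeneous in \<open>f\<close> and in \<open>g\<close>, so the rescaling can be undone.\<close>

lemma prekopa_leindler_real: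
  fixes f g h :: "real \<Rightarrow> real"
  assumes \<theta>: "0 < \<theta>" "\<theta> < 1"
    and int: "integrable lborel f" "integrable lborel g" "integrable lborel h"
    and nonneg: "\<And>x. 0 \<le> f x" "\<And>x. 0 \<le> g x" "\<And>x. 0 \<le> h x"
    and bdd: "bdd_above (range f)" "bdd_above (range g)"
    and h: "\<And>x y. f x powr (1 - \<theta>) * g y powr \<theta> \<le> h ((1 - \<theta>) * x + \<theta> * y)"
  shows "(\<integral>x. f x \<partial>lborel) powr (1 - \<theta>) * (\<integral>x. g x \<partial>lborel) powr \<theta> \<le> (\<integral>x. h x \<partial>lborel)"
proof -
  define If Ig Ih where I: "If = (\<integral>x. f x \<partial>lborel)" "Ig = (\<integral>x. g x \<partial>lborel)" "Ih = (\<integral>x. h x \<partial>lborel)"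
  have I0: "0 \<le> If" "0 \<le> Ig" "0 \<le> Ih"
    unfolding I using nonneg by (auto intro: integral_nonneg)
  show ?thesis
  proof (cases "If = 0 \<or> Ig = 0")
    case True
    then show ?thesis using I0 I by auto
  next
    case False
    define F G where FG: "F = (SUP x. f x)" "G = (SUP x. g x)"
    have le: "f x \<le> F" "g x \<le> G" for x
      unfolding FG using bdd by (auto intro: cSUP_upper)
    have "f \<noteq> (\<lambda>x. 0)" "g \<noteq> (\<lambda>x. 0)"
      using False unfolding I by auto
    then obtain x y where "f x \<noteq> 0" "g y \<noteq> 0"
      by (auto simp: fun_eq_iff)
    then have pos: "0 < F" "0 < G"
      using le(1)[of x] le(2)[of y] nonneg(1)[of x] nonneg(2)[of y] by auto
    define H where "H = F powr (1 - \<theta>) * G powr \<theta>"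
    have H: "0 < H" using pos by (simp add: H_def)
    have "(1 - \<theta>) * (\<integral>x. f x / F \<partial>lborel) + \<theta> * (\<integral>x. g x / G \<partial>lborel) \<le> (\<integral>x. h x / H \<partial>lborel)"
    proof (rule prekopa_leindler_normalized[OF \<theta>])
      show "\<exists>x. l < f x / F" if "l < 1" for l
        using less_cSUP_iff[OF _ bdd(1), of "l * F"] that pos by (auto simp: FG[symmetric] field_simps)
      show "\<exists>x. l < g x / G" if "l < 1" for l
        using less_cSUP_iff[OF _ bdd(2), of "l * G"] that pos by (auto simp: FG[symmetric] field_simps)
      show "(f x / F) powr (1 - \<theta>) * (g y / G) powr \<theta> \<le> h ((1 - \<theta>) * x + \<theta> * y) / H" for x y
        using h[of x y] pos nonneg H by (simp add: H_def powr_divide divide_right_mono)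
    qed (use int nonneg le pos H in auto)
    then have "(1 - \<theta>) * (If / F) + \<theta> * (Ig / G) \<le> Ih / H"
      by (simp add: I)
    moreover have "(If / F) powr (1 - \<theta>) * (Ig / G) powr \<theta> \<le> (1 - \<theta>) * (If / F) + \<theta> * (Ig / G)"
      using \<theta> False I0 pos by (intro Youngs_inequality_0) auto
    ultimately have "(If / F) powr (1 - \<theta>) * (Ig / G) powr \<theta> \<le> Ih / H"
      by linarith
    then show ?thesis
      using pos I0 H unfolding I[symmetric] by (simp add: powr_divide H_def divide_le_cancel)
  qed
qed

lemma integral_exp_substitution:
  fixes f :: "real \<Rightarrow> real"
  assumes [measurable]: "f \<in> borel_measurable borel"
    and f: "integrable lborel f" "\<And>x. x \<le> 0 \<Longrightarrow> f x = 0"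
  shows "integrable lborel (\<lambda>x. exp x * f (exp x))"
    and "(\<integral>x. exp x * f (exp x) \<partial>lborel) = (\<integral>x. f x \<partial>lborel)"
proof -
  have im: "range exp = {(0::real)<..}"
  proof (intro equalityI subsetI)
    fix x :: real assume "x \<in> {0<..}"
    then show "x \<in> range exp"
      using rangeI[of exp "ln x"] by simp
  qed auto
  have set: "(\<lambda>x. indicator {0<..} x *\<^sub>R f x) = f"
    using f(2) by (fastforce split: split_indicator)
  have 1: "f absolutely_integrable_on range exp"
    unfolding im set_integrable_def set using f(1) by (simp add: integrable_completion)
  have 2: "(\<lambda>x. \<bar>exp x\<bar> *\<^sub>R f (exp x)) absolutely_integrable_on UNIV \<and>
      integral UNIV (\<lambda>x. \<bar>exp x\<bar> *\<^sub>R f (exp x)) = integral (range exp) f"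
    using 1 has_absolute_integral_change_of_variables_real
      [of UNIV exp exp f "integral (range exp) f"] by (auto simp: inj_on_def intro!: derivative_eq_intros)
  then have "integrable lebesgue (\<lambda>x. exp x * f (exp x))"
    by (simp add: set_integrable_def)
  then show 3: "integrable lborel (\<lambda>x. exp x * f (exp x))"
    by (subst (asm) integrable_completion) auto
  have "(\<integral>x. exp x * f (exp x) \<partial>lborel) = integral UNIV (\<lambda>x. exp x * f (exp x))"
    using 3 by (simp add: integral_lborel)
  also have "\<dots> = integral (range exp) f"
    using 2 by simp
  also have "\<dots> = (LINT x:range exp|lebesgue. f x)"
    using set_lebesgue_integral_eq_integral(2)[OF 1] by simp
  also have "\<dots> = (\<integral>x. f x \<partial>lborel)"
    unfolding set_lebesgue_integral_def im set by (simp add: integral_completion)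
  finally show "(\<integral>x. exp x * f (exp x) \<partial>lborel) = (\<integral>x. f x \<partial>lborel)" .
qed

text \<open>The substitution \<open>x = e\<^sup>p\<close> turns geometric means of arguments into arithmetic
  means. Its Jacobian \<open>e\<^sup>p\<close> is log-linear, so multiplying \<open>f\<close>, \<open>g\<close> and
  \<open>h\<close> by it preserves the hypothesis; the price is that \<open>x f x\<close> rather than \<open>f\<close> has to
  be bounded.\<close>

lemma prekopa_leindler_multiplicative:
  fixes f g h :: "real \<Rightarrow> real"
  assumes \<theta>: "0 < \<theta>" "\<theta> < 1"
    and int: "integrable lborel f" "integrable lborel g" "integrable lborel h"
    and nonneg: "\<And>x. 0 \<le> f x" "\<And>x. 0 \<le> g x" "\<And>x. 0 \<le> h x"
    and zero: "\<And>x. x \<le> 0 \<Longrightarrow> f x = 0" "\<And>x. x \<le> 0 \<Longrightarrow> g x = 0" "\<And>x. x \<le> 0 \<Longrightarrow> h x = 0"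
    and bdd: "bdd_above (range (\<lambda>x. x * f x))" "bdd_above (range (\<lambda>x. x * g x))"
    and h: "\<And>x y. 0 < x \<Longrightarrow> 0 < y \<Longrightarrow>
      f x powr (1 - \<theta>) * g y powr \<theta> \<le> h (x powr (1 - \<theta>) * y powr \<theta>)"
  shows "(\<integral>x. f x \<partial>lborel) powr (1 - \<theta>) * (\<integral>x. g x \<partial>lborel) powr \<theta> \<le> (\<integral>x. h x \<partial>lborel)"
proof -
  have [measurable]: "f \<in> borel_measurable borel" "g \<in> borel_measurable borel" "h \<in> borel_measurable borel"
    using int by (auto dest: borel_measurable_integrable)
  have bdd': "bdd_above (range (\<lambda>x. exp x * k (exp x)))" if "bdd_above (range (\<lambda>x. x * k x))" for k :: "real \<Rightarrow> real"
    using that by (rule bdd_above_mono) auto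
  have "(\<integral>x. exp x * f (exp x) \<partial>lborel) powr (1 - \<theta>) * (\<integral>x. exp x * g (exp x) \<partial>lborel) powr \<theta>
      \<le> (\<integral>x. exp x * h (exp x) \<partial>lborel)"
  proof (rule prekopa_leindler_real[OF \<theta>])
    fix x y :: real
    have e: "exp ((1 - \<theta>) * x + \<theta> * y) = exp x powr (1 - \<theta>) * exp y powr \<theta>"
      by (simp add: exp_add exp_powr_real mult.commute)
    show "(exp x * f (exp x)) powr (1 - \<theta>) * (exp y * g (exp y)) powr \<theta>
        \<le> exp ((1 - \<theta>) * x + \<theta> * y) * h (exp ((1 - \<theta>) * x + \<theta> * y))"
      unfolding e using h[of "exp x" "exp y"] nonneg by (simp add: powr_mult mult_ac)
  qed (use int nonneg zero bdd in \<open>auto intro!: integral_exp_substitution bdd'\<close>)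
  then show ?thesis
    using int zero by (simp add: integral_exp_substitution)
qed

section \<open>Geometric means of sets in the open quadrant\<close>

lemma measure_eq_integral_slices:
  fixes S :: "(real \<times> real) set"
  assumes [measurable]: "S \<in> sets borel" and S: "bounded S"
  shows "integrable lborel (\<lambda>x. measure lborel (Pair x -` S))"
    and "(\<integral>x. measure lborel (Pair x -` S) \<partial>lborel) = measure lborel S"
proof -
  have sl: "Pair x -` S \<in> sets borel" for x
    by (rule measurable_sets_borel[OF _ assms(1)]) (intro borel_measurable_continuous_onI continuous_intros)
  obtain B where B: "\<And>p. p \<in> S \<Longrightarrow> norm p \<le> B"
    using S by (auto simp: bounded_iff)
  have "Pair x -` S \<subseteq> cball 0 B" for x
  proof
    fix y assume "y \<in> Pair x -` S"
    then show "y \<in> cball 0 B"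
      using B[of "(x, y)"] norm_snd_le[of y x] by simp
  qed
  then have fin: "emeasure lborel (Pair x -` S) < \<infinity>" for x
    by (intro emeasure_bounded_finite) (meson bounded_cball bounded_subset)
  have eq: "emeasure lborel (Pair x -` S) = ennreal (measure lborel (Pair x -` S))" for x
    using fin by (simp add: emeasure_eq_ennreal_measure less_top)
  have [measurable]: "(\<lambda>x. measure lborel (Pair x -` S)) \<in> borel_measurable borel"
    unfolding measure_def
    using lborel.measurable_emeasure_Pair[of S lborel] by (simp add: lborel_prod)
  have "(\<integral>\<^sup>+x. ennreal (measure lborel (Pair x -` S)) \<partial>lborel) = emeasure (lborel \<Otimes>\<^sub>M lborel) S"
    using assms(1) by (subst lborel.emeasure_pair_measure_alt) (simp_all add: lborel_prod eq flip: borel_prod)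
  also have "\<dots> = ennreal (measure lborel S)"
    unfolding lborel_prod using emeasure_bounded_finite[OF S]
    by (simp add: emeasure_eq_ennreal_measure less_top)
  finally have "has_bochner_integral lborel (\<lambda>x. measure lborel (Pair x -` S)) (measure lborel S)"
    by (intro has_bochner_integral_nn_integral) auto
  then show "integrable lborel (\<lambda>x. measure lborel (Pair x -` S))"
    and "(\<integral>x. measure lborel (Pair x -` S) \<partial>lborel) = measure lborel S"
    by (auto simp: has_bochner_integral_iff)
qed

text \<open>The one-dimensional inequality is used twice: for the indicator functions of two
  vertical slices it compares the slice lengths, and this comparison is precisely the hypothesis
  needed to apply it again to the slice lengths as functions of the abscissa.\<close>

theorem measure_geometric_mean_set_ge:
  fixes A B H :: "(real \<times> real) set"
  assumes \<theta>: "0 < \<theta>" "\<theta> < 1"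
    and borel: "A \<in> sets borel" "B \<in> sets borel" "H \<in> sets borel"
    and bdd: "bounded A" "bounded B" "bounded H"
    and pos: "A \<subseteq> {0<..} \<times> {0<..}" "B \<subseteq> {0<..} \<times> {0<..}" "H \<subseteq> {0<..} \<times> {0<..}"
    and H: "\<And>a b a' b'. (a, b) \<in> A \<Longrightarrow> (a', b') \<in> B \<Longrightarrow>
      (a powr (1 - \<theta>) * a' powr \<theta>, b powr (1 - \<theta>) * b' powr \<theta>) \<in> H"
  shows "measure lborel A powr (1 - \<theta>) * measure lborel B powr \<theta> \<le> measure lborel H"
proof -
  have sl: "Pair x -` S \<in> sets borel" if "S \<in> sets borel" for S :: "(real \<times> real) set" and x
    by (rule measurable_sets_borel[OF _ that]) (intro borel_measurable_continuous_onI continuous_intros)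
  have bound: "\<exists>M. (\<forall>p\<in>S. fst p \<le> M \<and> snd p \<le> M) \<and> 0 \<le> M" if S: "bounded S" for S :: "(real \<times> real) set"
  proof -
    obtain M where M: "\<And>p. p \<in> S \<Longrightarrow> norm p \<le> M"
      using S by (auto simp: bounded_iff)
    have "fst p \<le> \<bar>M\<bar> \<and> snd p \<le> \<bar>M\<bar>" if "p \<in> S" for p
      using M[OF that] norm_fst_le[of "fst p" "snd p"] norm_snd_le[of "snd p" "fst p"] by auto
    then show ?thesis by (intro exI[of _ "\<bar>M\<bar>"]) auto
  qed
  have slice_le: "\<exists>M\<ge>0. (\<forall>x. measure lborel (Pair x -` S) \<le> M \<and> Pair x -` S \<subseteq> {0..M}
       \<and> (x > M \<longrightarrow> Pair x -` S = {}))"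
    if S: "bounded S" "S \<subseteq> {0<..} \<times> {0<..}" for S :: "(real \<times> real) set"
  proof -
    obtain M where M: "\<And>p. p \<in> S \<Longrightarrow> fst p \<le> M \<and> snd p \<le> M" "0 \<le> M"
      using bound[OF S(1)] by blast
    have sub: "Pair x -` S \<subseteq> {0..M}" for x
      using M(1) S(2) by fastforce
    have "measure lborel (Pair x -` S) \<le> M" for x
    proof -
      have "emeasure lborel (Pair x -` S) \<le> ennreal M"
        using emeasure_mono[OF sub[of x], of lborel] M(2) by simp
      then show ?thesis
        using M(2) by (simp add: measure_def enn2real_leI)
    qed
    moreover have "Pair x -` S = {}" if "x > M" for x
      using M(1) that by fastforce
    ultimately show ?thesis
      using M(2) sub by blast
  qed
  have mult_bdd: "bdd_above (range (\<lambda>x. x * measure lborel (Pair x -` S)))"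
    if S: "bounded S" "S \<subseteq> {0<..} \<times> {0<..}" for S :: "(real \<times> real) set"
  proof -
    obtain M where M: "0 \<le> M" "\<And>x. measure lborel (Pair x -` S) \<le> M"
        "\<And>x. x > M \<Longrightarrow> Pair x -` S = {}"
      using slice_le[OF S] by blast
    have "x * measure lborel (Pair x -` S) \<le> M * M" for x
    proof (cases "x > M")
      case False
      then show ?thesis
        using M by (intro mult_mono) auto
    qed (use M in simp)
    then show ?thesis by (auto intro!: bdd_aboveI[of _ "M * M"])
  qed
  have slice: "measure lborel (Pair x -` A) powr (1 - \<theta>) * measure lborel (Pair y -` B) powr \<theta>
      \<le> measure lborel (Pair (x powr (1 - \<theta>) * y powr \<theta>) -` H)" for x y
  proof -
    have ind: "integrable lborel (indicat_real (Pair z -` S))"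
      "bdd_above (range (\<lambda>y. y * indicat_real (Pair z -` S) y))"
      if S: "bounded S" "S \<subseteq> {0<..} \<times> {0<..}" "S \<in> sets borel"
      for S :: "(real \<times> real) set" and z
    proof -
      obtain M where M: "0 \<le> M" "\<And>x. Pair x -` S \<subseteq> {0..M}"
        using slice_le[OF S(1,2)] by blast
      have "bounded (Pair z -` S)"
        using M(2) bounded_subset bounded_closed_interval by metis
      then show "integrable lborel (indicat_real (Pair z -` S))"
        using sl[OF S(3)] emeasure_bounded_finite by (intro integrable_real_indicator) simp_all
      show "bdd_above (range (\<lambda>y. y * indicat_real (Pair z -` S) y))"
        using M by (intro bdd_aboveI[of _ M]) (force split: split_indicator)
    qed
    have "(\<integral>b. indicat_real (Pair x -` A) b \<partial>lborel) powr (1 - \<theta>)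
        * (\<integral>b. indicat_real (Pair y -` B) b \<partial>lborel) powr \<theta>
        \<le> (\<integral>b. indicat_real (Pair (x powr (1 - \<theta>) * y powr \<theta>) -` H) b \<partial>lborel)"
    proof (rule prekopa_leindler_multiplicative[OF \<theta>])
      show "indicat_real (Pair x -` A) b powr (1 - \<theta>) * indicat_real (Pair y -` B) b' powr \<theta>
          \<le> indicat_real (Pair (x powr (1 - \<theta>) * y powr \<theta>) -` H) (b powr (1 - \<theta>) * b' powr \<theta>)"
        for b b'
        using H by (auto split: split_indicator)
    qed (use pos in \<open>auto intro!: ind bdd borel split: split_indicator\<close>)
    then show ?thesis
      using sl borel by simp
  qed
  have "(\<integral>x. measure lborel (Pair x -` A) \<partial>lborel) powr (1 - \<theta>)
      * (\<integral>x. measure lborel (Pair x -` B) \<partial>lborel) powr \<theta>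
      \<le> (\<integral>x. measure lborel (Pair x -` H) \<partial>lborel)"
  proof (rule prekopa_leindler_multiplicative[OF \<theta>])
    have "Pair x -` S = {}" if "S \<subseteq> {0<..} \<times> {0<..}" "x \<le> 0" for S :: "(real \<times> real) set" and x
      using that by fastforce
    then show "measure lborel (Pair x -` A) = 0" "measure lborel (Pair x -` B) = 0"
      "measure lborel (Pair x -` H) = 0" if "x \<le> 0" for x
      using that pos by simp_all
  qed (intro measure_eq_integral_slices(1) mult_bdd slice measure_nonneg bdd borel pos)+
  then show ?thesis
    by (simp add: measure_eq_integral_slices borel bdd)
qed

section \<open>Sectors bounded by reflection lines\<close>

definition direction :: "real \<Rightarrow> real^2" where
  "direction \<phi> = vector [cos \<phi>, sin \<phi>]"

definition sector :: "real \<Rightarrow> real \<Rightarrow> (real^2) set" where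
  "sector \<alpha> \<beta> = {r *\<^sub>R direction \<phi> | r \<phi>. 0 < r \<and> \<alpha> < \<phi> \<and> \<phi> < \<beta>}"

lemma direction_nth [simp]: "direction \<phi> $ 1 = cos \<phi>" "direction \<phi> $ 2 = sin \<phi>"
  by (simp_all add: direction_def)

lemma reflect_line_direction:
  "reflect_line (direction \<alpha>) (r *\<^sub>R direction \<phi>) = r *\<^sub>R direction (2 * \<alpha> - \<phi>)"
proof -
  have 1: "direction \<alpha> \<bullet> direction \<alpha> = 1"
    by (simp add: inner_vec_def sum_2 flip: power2_eq_square)
  have 2: "direction \<phi> \<bullet> direction \<alpha> = cos (\<phi> - \<alpha>)"
    by (simp add: inner_vec_def sum_2 cos_diff)
  have "2 * cos (\<phi> - \<alpha>) * cos \<alpha> - cos \<phi> = cos (2 * \<alpha> - \<phi>)"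
    using cos_add[of "\<alpha> - \<phi>" \<alpha>] cos_diff[of "\<alpha> - \<phi>" \<alpha>] cos_minus[of "\<phi> - \<alpha>"]
    by (simp add: algebra_simps)
  moreover have "2 * cos (\<phi> - \<alpha>) * sin \<alpha> - sin \<phi> = sin (2 * \<alpha> - \<phi>)"
    using sin_add[of "\<alpha> - \<phi>" \<alpha>] sin_diff[of "\<alpha> - \<phi>" \<alpha>] cos_minus[of "\<phi> - \<alpha>"]
    by (simp add: algebra_simps)
  ultimately have 3: "(2 * cos (\<phi> - \<alpha>)) *\<^sub>R direction \<alpha> - direction \<phi> = direction (2 * \<alpha> - \<phi>)"
    by (simp add: vec_eq_iff forall_2)
  have "reflect_line (direction \<alpha>) (r *\<^sub>R direction \<phi>)
      = r *\<^sub>R ((2 * cos (\<phi> - \<alpha>)) *\<^sub>R direction \<alpha> - direction \<phi>)"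
    by (simp add: reflect_line_def 1 2 scaleR_diff_right mult_ac)
  then show ?thesis
    unfolding 3 .
qed

lemma polar_coordinates:
  fixes x :: "real^2"
  obtains r \<phi> where "0 \<le> r" "0 \<le> \<phi>" "\<phi> < 2 * pi" "x = r *\<^sub>R direction \<phi>"
proof (cases "x = 0")
  case True
  then show ?thesis using that[of 0 0] by simp
next
  case False
  then have n: "norm x > 0" by simp
  have "(x $ 1)\<^sup>2 + (x $ 2)\<^sup>2 = (norm x)\<^sup>2"
    unfolding power2_norm_eq_inner by (simp add: inner_vec_def sum_2 power2_eq_square)
  then have "(x $ 1 / norm x)\<^sup>2 + (x $ 2 / norm x)\<^sup>2 = 1"
    using n by (simp add: power_divide flip: add_divide_distrib)
  then obtain \<phi> where "0 \<le> \<phi>" "\<phi> < 2 * pi" "x $ 1 / norm x = cos \<phi>" "x $ 2 / norm x = sin \<phi>"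
    using sincos_total_2pi by metis
  then show ?thesis
    using n that[of "norm x" \<phi>] by (simp add: vec_eq_iff forall_2 flip: \<open>x $ 1 / norm x = cos \<phi>\<close> \<open>x $ 2 / norm x = sin \<phi>\<close>)
qed

lemma direction_eqD:
  assumes "r *\<^sub>R direction \<phi> = r' *\<^sub>R direction \<psi>" "0 < r" "0 < r'" "\<bar>\<phi> - \<psi>\<bar> < 2 * pi"
  shows "\<phi> = \<psi>"
proof -
  have n: "norm (direction t) = 1" for t
    by (simp add: norm_eq_1 inner_vec_def sum_2 flip: power2_eq_square)
  have "r = r'"
    using arg_cong[OF assms(1), of norm] assms(2,3) by (simp add: n)
  then have "sin \<phi> = sin \<psi> \<and> cos \<phi> = cos \<psi>"
    using assms by (metis direction_nth scaleR_left_imp_eq less_irrefl)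
  then obtain m :: int where m: "\<phi> = \<psi> + 2 * pi * m"
    using sin_cos_eq_iff by blast
  then have "\<bar>real_of_int m\<bar> * (2 * pi) < 1 * (2 * pi)"
    using assms(4) by (simp add: abs_mult mult.commute)
  then have "\<bar>real_of_int m\<bar> < 1"
    by (subst (asm) mult_less_cancel_right_pos) auto
  then have "m = 0" by linarith
  then show ?thesis using m by simp
qed

lemma reflect_line_sector:
  "reflect_line (direction \<beta>) ` sector \<alpha> \<beta> = sector \<beta> (2 * \<beta> - \<alpha>)"
proof (intro equalityI subsetI)
  fix x assume "x \<in> reflect_line (direction \<beta>) ` sector \<alpha> \<beta>"
  then obtain r \<phi> where "x = r *\<^sub>R direction (2 * \<beta> - \<phi>)" "0 < r" "\<alpha> < \<phi>" "\<phi> < \<beta>"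
    by (auto simp: sector_def reflect_line_direction)
  then show "x \<in> sector \<beta> (2 * \<beta> - \<alpha>)"
    unfolding sector_def by (intro CollectI exI[of _ r] exI[of _ "2 * \<beta> - \<phi>"]) auto
next
  fix x assume "x \<in> sector \<beta> (2 * \<beta> - \<alpha>)"
  then obtain r \<phi> where x: "x = r *\<^sub>R direction \<phi>" "0 < r" "\<beta> < \<phi>" "\<phi> < 2 * \<beta> - \<alpha>"
    by (auto simp: sector_def)
  then have "x = reflect_line (direction \<beta>) (r *\<^sub>R direction (2 * \<beta> - \<phi>))"
    by (simp add: reflect_line_direction)
  moreover have "r *\<^sub>R direction (2 * \<beta> - \<phi>) \<in> sector \<alpha> \<beta>"
    unfolding sector_def using x by (intro CollectI exI[of _ r] exI[of _ "2 * \<beta> - \<phi>"]) auto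
  ultimately show "x \<in> reflect_line (direction \<beta>) ` sector \<alpha> \<beta>"
    by blast
qed

lemma negligible_line_direction: "negligible (range (\<lambda>r. r *\<^sub>R direction \<phi>))"
proof (rule negligible_subset)
  have "vector [- sin \<phi>, cos \<phi>] \<noteq> (0 :: real^2)"
    using sin_zero_abs_cos_one[of \<phi>] by (auto simp: vec_eq_iff forall_2)
  then show "negligible {x :: real^2. vector [- sin \<phi>, cos \<phi>] \<bullet> x = 0}"
    by (intro negligible_hyperplane) auto
qed (auto simp: inner_vec_def sum_2)

text \<open>By the sine rule, a vector at angle \<open>\<phi>\<close> has coefficients proportional to
  \<open>sin (\<delta> - \<phi>)\<close> and \<open>sin \<phi>\<close> along the two edges; for an angle in \<open>[0, 2\<pi>)\<close> both are
  positive exactly when \<open>0 < \<phi> < \<delta>\<close>.\<close>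

lemma sector_eq_cone:
  assumes \<delta>: "0 < \<delta>" "\<delta> < pi"
  shows "sector 0 \<delta> = {a *\<^sub>R direction 0 + b *\<^sub>R direction \<delta> | a b. 0 < a \<and> 0 < b}"
proof (intro equalityI subsetI)
  have s: "sin \<delta> > 0" using \<delta> sin_gt_zero by blast
  fix x assume "x \<in> sector 0 \<delta>"
  then obtain r \<phi> where x: "x = r *\<^sub>R direction \<phi>" "0 < r" "0 < \<phi>" "\<phi> < \<delta>"
    by (auto simp: sector_def)
  have "x = (r * sin (\<delta> - \<phi>) / sin \<delta>) *\<^sub>R direction 0 + (r * sin \<phi> / sin \<delta>) *\<^sub>R direction \<delta>"
    using s x(1) by (simp add: vec_eq_iff forall_2 sin_diff field_simps)
  moreover have "0 < r * sin (\<delta> - \<phi>) / sin \<delta>" "0 < r * sin \<phi> / sin \<delta>"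
    using x \<delta> s by (simp_all add: sin_gt_zero)
  ultimately show "x \<in> {a *\<^sub>R direction 0 + b *\<^sub>R direction \<delta> | a b. 0 < a \<and> 0 < b}"
    by blast
next
  have s: "sin \<delta> > 0" using \<delta> sin_gt_zero by blast
  fix x assume "x \<in> {a *\<^sub>R direction 0 + b *\<^sub>R direction \<delta> | a b. 0 < a \<and> 0 < b}"
  then obtain a b where x: "x = a *\<^sub>R direction 0 + b *\<^sub>R direction \<delta>" "0 < a" "0 < b"
    by blast
  obtain r \<phi> where p: "0 \<le> r" "0 \<le> \<phi>" "\<phi> < 2 * pi" "x = r *\<^sub>R direction \<phi>"
    by (rule polar_coordinates)
  have e: "r * cos \<phi> = a + b * cos \<delta>" "r * sin \<phi> = b * sin \<delta>"
    using p(4) unfolding x(1) by (auto simp: vec_eq_iff forall_2)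
  have "r * sin \<phi> > 0" unfolding e using x s by simp
  then have "r > 0" "sin \<phi> > 0"
    using p(1) by (auto simp: zero_less_mult_iff)
  moreover have "r * sin (\<delta> - \<phi>) = a * sin \<delta>"
  proof -
    have "r * sin (\<delta> - \<phi>) = (r * cos \<phi>) * sin \<delta> - (r * sin \<phi>) * cos \<delta>"
      by (simp add: sin_diff algebra_simps)
    then show ?thesis
      unfolding e by (simp add: algebra_simps)
  qed
  then have "r * sin (\<delta> - \<phi>) > 0"
    using x s by simp
  then have "sin (\<delta> - \<phi>) > 0"
    using p(1) by (auto simp: zero_less_mult_iff)
  moreover have "\<phi> < pi"
  proof (rule ccontr)
    assume "\<not> \<phi> < pi"
    then have "sin \<phi> \<le> 0"
      using p(3) sin_le_zero[of \<phi>] by simp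
    then show False using \<open>sin \<phi> > 0\<close> by simp
  qed
  moreover have "\<phi> \<noteq> 0" using \<open>sin \<phi> > 0\<close> by auto
  moreover have "\<phi> < \<delta>"
  proof (rule ccontr)
    assume "\<not> \<phi> < \<delta>"
    then have "0 \<le> sin (\<phi> - \<delta>)"
      using \<open>\<phi> < pi\<close> \<delta> by (intro sin_ge_zero) auto
    then show False
      using \<open>sin (\<delta> - \<phi>) > 0\<close> sin_minus[of "\<phi> - \<delta>"] by simp
  qed
  ultimately show "x \<in> sector 0 \<delta>"
    unfolding sector_def using p by (intro CollectI exI[of _ r] exI[of _ \<phi>]) auto
qed

lemma borel_sector:
  assumes \<delta>: "0 < \<delta>" "\<delta> < pi"
  shows "sector 0 \<delta> \<in> sets borel"
proof -
  have s: "sin \<delta> > 0" using \<delta> sin_gt_zero by blast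
  have "sector 0 \<delta> = {x. 0 < x $ 1 * sin \<delta> - x $ 2 * cos \<delta> \<and> 0 < x $ 2}"
    unfolding sector_eq_cone[OF \<delta>]
  proof (intro equalityI subsetI)
    fix x :: "real^2" assume "x \<in> {x. 0 < x $ 1 * sin \<delta> - x $ 2 * cos \<delta> \<and> 0 < x $ 2}"
    then show "x \<in> {a *\<^sub>R direction 0 + b *\<^sub>R direction \<delta> | a b. 0 < a \<and> 0 < b}"
      using s by (intro CollectI exI[of _ "(x $ 1 * sin \<delta> - x $ 2 * cos \<delta>) / sin \<delta>"] exI[of _ "x $ 2 / sin \<delta>"])
        (auto simp: vec_eq_iff forall_2 field_simps)
  qed (use s in \<open>auto simp: algebra_simps\<close>)
  also have "open \<dots>"
    by (intro open_Collect_conj open_Collect_less continuous_intros)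
  finally show ?thesis by simp
qed

text \<open>Invariance under the two generating reflections propagates to the reflections across
  all lines at angles \<open>k \<pi> / n\<close>: conjugating the reflection across line \<open>k\<close> by the one across
  line \<open>k + 1\<close> gives the reflection across line \<open>k + 2\<close>. Each of these swaps two neighbouring
  sectors, so the \<open>2 n\<close> sectors around the origin carry equal shares of \<open>S\<close>, and they exhaust
  the plane up to finitely many lines.\<close>

lemma measure_eq_fundamental_sector:
  fixes S :: "(real^2) set" and n :: nat
  assumes n: "n \<ge> 2" and S: "S \<in> lmeasurable"
    and sym: "reflect_line (direction 0) ` S = S" "reflect_line (direction (pi / n)) ` S = S"
  shows "measure lebesgue S = 2 * n * measure lebesgue (S \<inter> sector 0 (pi / n))"
proof -
  define \<delta> where "\<delta> = pi / n"
  have \<delta>: "0 < \<delta>" "\<delta> < pi" "real n * \<delta> = pi"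
    using n by (simp_all add: \<delta>_def field_simps)
  define \<rho> where "\<rho> k = reflect_line (direction (real k * \<delta>))" for k
  define W where "W k = S \<inter> sector (real k * \<delta>) (real (Suc k) * \<delta>)" for k
  have rho_step: "\<rho> (Suc (Suc k)) = \<rho> (Suc k) \<circ> \<rho> k \<circ> \<rho> (Suc k)" for k
  proof
    fix x
    obtain r \<phi> where "x = r *\<^sub>R direction \<phi>"
      using polar_coordinates by metis
    then show "\<rho> (Suc (Suc k)) x = (\<rho> (Suc k) \<circ> \<rho> k \<circ> \<rho> (Suc k)) x"
      by (simp add: \<rho>_def reflect_line_direction algebra_simps)
  qed
  have rho: "\<rho> k ` S = S \<and> \<rho> (Suc k) ` S = S" for k
  proof (induction k)
    case 0
    then show ?case using sym by (simp add: \<rho>_def \<delta>_def)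
  next
    case (Suc k)
    have "\<rho> (Suc (Suc k)) ` S = \<rho> (Suc k) ` \<rho> k ` \<rho> (Suc k) ` S"
      by (simp only: rho_step image_comp comp_assoc)
    then show ?case using Suc by simp
  qed
  have orth: "orthogonal_transformation (\<rho> k)" for k
    by (simp add: \<rho>_def orthogonal_transformation_reflect_line)
  have W_Suc: "W (Suc k) = \<rho> (Suc k) ` W k" for k
  proof -
    have "inj (\<rho> (Suc k))"
      using orth orthogonal_transformation_inj by blast
    then have "\<rho> (Suc k) ` W k = \<rho> (Suc k) ` S \<inter> \<rho> (Suc k) ` sector (real k * \<delta>) (real (Suc k) * \<delta>)"
      unfolding W_def by (rule image_Int)
    also have "\<dots> = S \<inter> sector (real (Suc k) * \<delta>) (2 * (real (Suc k) * \<delta>) - real k * \<delta>)"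
      using rho[of k] by (simp only: \<rho>_def reflect_line_sector)
    also have "2 * (real (Suc k) * \<delta>) - real k * \<delta> = real (Suc (Suc k)) * \<delta>"
      by (simp add: algebra_simps)
    finally show ?thesis by (simp add: W_def)
  qed
  have W: "W k \<in> lmeasurable \<and> measure lebesgue (W k) = measure lebesgue (W 0)" for k
  proof (induction k)
    case 0
    have "sector 0 \<delta> \<in> sets lebesgue"
      using borel_sector[OF \<delta>(1,2)] by (simp add: sets_completionI_sets)
    then show ?case
      using S by (auto simp: W_def intro: fmeasurable_Int_fmeasurable)
  next
    case (Suc k)
    then show ?case
      using orth by (simp add: W_Suc measurable_orthogonal_image measure_orthogonal_image)
  qed
  have disj: "W k \<inter> W l = {}" if "k < l" "l < 2 * n" for k l
  proof (rule ccontr)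
    assume "W k \<inter> W l \<noteq> {}"
    then obtain r \<phi> r' \<psi> where e: "r *\<^sub>R direction \<phi> = r' *\<^sub>R direction \<psi>" "0 < r" "0 < r'"
      and b: "real k * \<delta> < \<phi>" "\<phi> < real (Suc k) * \<delta>" "real l * \<delta> < \<psi>" "\<psi> < real (Suc l) * \<delta>"
      by (auto simp: W_def sector_def)
    have "real (Suc k) * \<delta> \<le> real l * \<delta>" "real (Suc l) * \<delta> \<le> real (2 * n) * \<delta>" "0 \<le> real k * \<delta>"
      using that \<delta>(1) by (auto intro!: mult_right_mono simp del: of_nat_Suc)
    moreover have "real (2 * n) * \<delta> = 2 * pi" using \<delta>(3) by simp
    ultimately have lt: "\<phi> < \<psi>" "\<bar>\<phi> - \<psi>\<bar> < 2 * pi"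
      using b by linarith+
    then show False using direction_eqD[OF e] by simp
  qed
  have "measure lebesgue S = measure lebesgue (\<Union>k<2*n. W k)"
  proof (rule measure_negligible_symdiff[symmetric])
    show "S \<in> lmeasurable" by fact
    have "S - (\<Union>k<2*n. W k) \<subseteq> (\<Union>k<2*n. range (\<lambda>r. r *\<^sub>R direction (real k * \<delta>)))"
    proof
      fix x assume x: "x \<in> S - (\<Union>k<2*n. W k)"
      obtain r \<phi> where p: "0 \<le> r" "0 \<le> \<phi>" "\<phi> < 2 * pi" "x = r *\<^sub>R direction \<phi>"
        by (rule polar_coordinates)
      \<comment> \<open>The index of the sector that contains \<open>x\<close>, unless \<open>x\<close> lies on its first edge.\<close>
      define k where "k = nat \<lfloor>\<phi> / \<delta>\<rfloor>"
      have "0 \<le> \<phi> / \<delta>" using p \<delta> by simp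
      then have "real k \<le> \<phi> / \<delta>" "\<phi> / \<delta> < real (Suc k)"
        unfolding k_def by linarith+
      then have k: "real k * \<delta> \<le> \<phi>" "\<phi> < real (Suc k) * \<delta>"
        using \<delta>(1) by (simp_all add: field_simps)
      have "real k * \<delta> < real (2 * n) * \<delta>"
        using k(1) p(3) \<delta>(3) by simp
      then have k2: "k < 2 * n"
        using \<delta>(1) by (simp add: mult_less_cancel_right)
      have "r = 0 \<or> \<phi> = real k * \<delta>"
      proof (rule ccontr)
        assume "\<not> (r = 0 \<or> \<phi> = real k * \<delta>)"
        then have "x \<in> sector (real k * \<delta>) (real (Suc k) * \<delta>)"
          unfolding sector_def using p k by (intro CollectI exI[of _ r] exI[of _ \<phi>]) auto
        then show False using x k2 by (auto simp: W_def)
      qed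
      then have "x \<in> range (\<lambda>r. r *\<^sub>R direction (real k * \<delta>))"
        using p(4) by (auto intro: range_eqI[of _ _ 0])
      then show "x \<in> (\<Union>k<2*n. range (\<lambda>r. r *\<^sub>R direction (real k * \<delta>)))"
        using k2 by blast
    qed
    moreover have "negligible (\<Union>k<2*n. range (\<lambda>r. r *\<^sub>R direction (real k * \<delta>)))"
      by (auto intro!: negligible_Union negligible_line_direction)
    moreover have "(\<Union>k<2*n. W k) - S = {}" by (auto simp: W_def)
    ultimately show "negligible (S - (\<Union>k<2*n. W k) \<union> ((\<Union>k<2*n. W k) - S))"
      by (metis negligible_subset Un_empty_right)
  qed
  also have "\<dots> = (\<Sum>k<2*n. measure lebesgue (W k))"
  proof (rule measure_negligible_finite_Union_image)
    show "pairwise (\<lambda>k l. negligible (W k \<inter> W l)) {..<2 * n}"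
      unfolding pairwise_def
      by (metis disj lessThan_iff negligible_empty inf_commute nat_neq_iff)
  qed (use W in auto)
  also have "\<dots> = (\<Sum>k<2*n. measure lebesgue (W 0))"
    by (rule sum.cong[OF refl]) (rule W[THEN conjunct2])
  also have "\<dots> = 2 * n * measure lebesgue (W 0)"
    by simp
  finally show ?thesis by (simp add: W_def \<delta>_def)
qed

section \<open>Coordinates along the edges of a sector\<close>

definition cone_coords :: "real \<Rightarrow> (real^2) set \<Rightarrow> (real \<times> real) set" where
  "cone_coords \<delta> S = {(a, b). 0 < a \<and> 0 < b \<and> a *\<^sub>R direction 0 + b *\<^sub>R direction \<delta> \<in> S}"

text \<open>Fubini's theorem is about product types, so areas in \<open>real^2\<close> have to be
  transported to pairs; boxes, which determine Lebesgue measure, correspond.\<close>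

lemma distr_lborel_vec2: "distr lborel borel (\<lambda>x :: real^2. (x $ 1, x $ 2)) = lborel"
proof (rule lborel_eqI[symmetric])
  have [measurable]: "(\<lambda>x :: real^2. (x $ 1, x $ 2)) \<in> borel_measurable borel"
    by (intro borel_measurable_continuous_onI continuous_intros)
  fix l u :: "real \<times> real" assume le: "\<And>b. b \<in> Basis \<Longrightarrow> l \<bullet> b \<le> u \<bullet> b"
  obtain l1 l2 u1 u2 where lu: "l = (l1, l2)" "u = (u1, u2)"
    by (metis surj_pair)
  have le12: "l1 \<le> u1" "l2 \<le> u2"
    using le[of "(1, 0)"] le[of "(0, 1)"] by (auto simp: lu Basis_prod_def)
  have basis: "(Basis :: (real^2) set) = {axis 1 1, axis 2 1}"
    by (auto simp: Basis_vec_def UNIV_2)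
  have ne: "axis 1 (1::real) \<noteq> (axis 2 1 :: real^2)"
    by (simp add: axis_eq_axis)
  have pre: "(\<lambda>x :: real^2. (x $ 1, x $ 2)) -` box l u = box (vector [l1, l2]) (vector [u1, u2])"
    by (auto simp: lu mem_box_cart forall_2 mem_box Basis_prod_def)
  have "emeasure (distr lborel borel (\<lambda>x :: real^2. (x $ 1, x $ 2))) (box l u)
      = emeasure lborel (box (vector [l1, l2]) (vector [u1, u2]) :: (real^2) set)"
    by (subst emeasure_distr) (simp_all add: pre)
  also have "\<dots> = (\<Prod>b\<in>Basis. (vector [u1, u2] - vector [l1, l2] :: real^2) \<bullet> b)"
    using le12 by (intro emeasure_lborel_box) (auto simp: basis inner_axis)
  also have "\<dots> = (\<Prod>b\<in>Basis. (u - l) \<bullet> b)"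
    using ne le12 by (simp add: basis inner_axis lu Basis_prod_def ennreal_mult mult.commute)
  finally show "emeasure (distr lborel borel (\<lambda>x :: real^2. (x $ 1, x $ 2))) (box l u)
      = (\<Prod>b\<in>Basis. (u - l) \<bullet> b)" .
qed simp

lemma cone_coords_regular:
  assumes \<delta>: "0 < \<delta>" "\<delta> < pi" and S: "compact S"
  shows "cone_coords \<delta> S \<in> sets borel" "bounded (cone_coords \<delta> S)"
    and "measure lebesgue (S \<inter> sector 0 \<delta>) = sin \<delta> * measure lborel (cone_coords \<delta> S)"
proof -
  have s: "sin \<delta> > 0" using \<delta> sin_gt_zero by blast
  define T :: "real \<times> real \<Rightarrow> real^2" where "T p = fst p *\<^sub>R direction 0 + snd p *\<^sub>R direction \<delta>" for p
  have eq: "cone_coords \<delta> S = ({0<..} \<times> {0<..}) \<inter> T -` S"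
    by (auto simp: cone_coords_def T_def)
  have "closed (T -` S)"
    unfolding T_def by (intro closed_vimage continuous_intros compact_imp_closed S)
  moreover have "open ({0<..} \<times> {0<..} :: (real \<times> real) set)"
    by (intro open_Times open_greaterThan)
  ultimately show borel: "cone_coords \<delta> S \<in> sets borel"
    unfolding eq by auto
  define f g :: "real^2 \<Rightarrow> real^2"
    where "f = (\<lambda>x. x $ 1 *\<^sub>R direction 0 + x $ 2 *\<^sub>R direction \<delta>)"
      and "g = (\<lambda>y. vector [y $ 1 - y $ 2 * cos \<delta> / sin \<delta>, y $ 2 / sin \<delta>])"
  \<comment> \<open>The coordinate set as a subset of \<open>real^2\<close>, so that the area formula for linear maps applies.\<close>
  define E where "E = (\<lambda>x :: real^2. (x $ 1, x $ 2)) -` cone_coords \<delta> S"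
  have lin: "linear f" "linear g"
    unfolding f_def g_def by (auto intro!: linearI simp: vec_eq_iff forall_2 algebra_simps add_divide_distrib)
  have gf: "g (f x) = x" for x
    using s by (simp add: f_def g_def vec_eq_iff forall_2)
  have fE: "f ` E = S \<inter> sector 0 \<delta>"
  proof (intro equalityI subsetI)
    fix y assume y: "y \<in> S \<inter> sector 0 \<delta>"
    then obtain a b where ab: "y = a *\<^sub>R direction 0 + b *\<^sub>R direction \<delta>" "0 < a" "0 < b"
      by (auto simp: sector_eq_cone[OF \<delta>])
    then have "y = f (vector [a, b])" "vector [a, b] \<in> E"
      using y by (auto simp: f_def E_def cone_coords_def)
    then show "y \<in> f ` E" by blast
  qed (auto simp: E_def cone_coords_def f_def sector_eq_cone[OF \<delta>])
  have Eg: "E = g ` (S \<inter> sector 0 \<delta>)"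
    unfolding fE[symmetric] by (simp add: image_image gf)
  have bE: "bounded E"
    unfolding Eg using lin(2) compact_imp_bounded[OF S]
    by (intro bounded_linear_image) (auto simp: linear_linear)
  have proj: "(\<lambda>x :: real^2. (x $ 1, x $ 2)) \<in> borel_measurable borel"
    by (intro borel_measurable_continuous_onI continuous_intros)
  have Eb: "E \<in> sets borel"
    unfolding E_def by (rule measurable_sets_borel[OF proj borel])
  have Em: "E \<in> lmeasurable"
    using bE Eb by (intro bounded_set_imp_lmeasurable) (auto simp: sets_completionI_sets)
  have "cone_coords \<delta> S = (\<lambda>x :: real^2. (x $ 1, x $ 2)) ` E"
  proof (intro equalityI subsetI)
    fix p assume "p \<in> cone_coords \<delta> S"
    then show "p \<in> (\<lambda>x :: real^2. (x $ 1, x $ 2)) ` E"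
      by (intro image_eqI[of _ _ "vector [fst p, snd p]"]) (auto simp: E_def)
  qed (auto simp: E_def)
  moreover have "bounded_linear (\<lambda>x :: real^2. (x $ 1, x $ 2))"
    by (intro bounded_linear_Pair bounded_linear_vec_nth)
  ultimately show "bounded (cone_coords \<delta> S)"
    using bE by (simp add: bounded_linear_image)
  have "measure lborel (cone_coords \<delta> S) = measure (distr lborel borel (\<lambda>x :: real^2. (x $ 1, x $ 2))) (cone_coords \<delta> S)"
    by (simp add: distr_lborel_vec2)
  also have "\<dots> = measure lebesgue E"
    using proj borel Eb by (simp add: measure_distr E_def)
  finally have 1: "measure lborel (cone_coords \<delta> S) = measure lebesgue E" .
  have "det (matrix f) = sin \<delta>"
    by (simp add: det_2 matrix_def f_def axis_def)
  then show "measure lebesgue (S \<inter> sector 0 \<delta>) = sin \<delta> * measure lborel (cone_coords \<delta> S)"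
    unfolding 1 fE[symmetric] using measure_linear_image[OF lin(1) Em] s by simp
qed

section \<open>Symmetric convex sets in edge coordinates\<close>

lemma inner_direction: "direction \<alpha> \<bullet> direction \<beta> = cos (\<alpha> - \<beta>)"
  by (simp add: inner_vec_def sum_2 cos_diff)

text \<open>The foot of the perpendicular on the mirror is the midpoint of \<open>x\<close> and its mirror image.\<close>

lemma projection_mem:
  assumes K: "convex K" "reflect_line (direction \<alpha>) ` K = K" and x: "x \<in> K"
  shows "(x \<bullet> direction \<alpha>) *\<^sub>R direction \<alpha> \<in> K"
proof -
  have "reflect_line (direction \<alpha>) x \<in> K"
    using K x by blast
  then have "(1/2) *\<^sub>R x + (1/2) *\<^sub>R reflect_line (direction \<alpha>) x \<in> K"
    using K x by (intro convexD) auto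
  then show ?thesis
    by (simp add: reflect_line_def inner_direction scaleR_diff_right)
qed

text \<open>The point of \<open>K\<close> nearest to the origin cannot get closer when projected to a mirror,
  so it lies on both mirrors, which meet only in the origin.\<close>

lemma zero_mem_of_two_reflections:
  assumes K: "convex K" "closed K" "K \<noteq> {}"
    and sym: "reflect_line (direction \<alpha>) ` K = K" "reflect_line (direction \<beta>) ` K = K"
    and s: "sin (\<beta> - \<alpha>) \<noteq> 0"
  shows "0 \<in> K"
proof -
  obtain m where m: "m \<in> K" "\<And>y. y \<in> K \<Longrightarrow> dist 0 m \<le> dist 0 y"
    using distance_attains_inf[OF K(2,3), of 0] by blast
  have fixed: "m = (m \<bullet> direction \<phi>) *\<^sub>R direction \<phi>"
    if "reflect_line (direction \<phi>) ` K = K" for \<phi>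
  proof -
    define q where "q = (m \<bullet> direction \<phi>) *\<^sub>R direction \<phi>"
    have "norm m \<le> norm q"
      using m(2)[OF projection_mem[OF K(1) that m(1)]] by (simp add: q_def)
    then have "m \<bullet> m \<le> q \<bullet> q"
      by (simp add: norm_le)
    moreover have "(m - q) \<bullet> (m - q) = m \<bullet> m - q \<bullet> q"
      by (simp add: q_def inner_diff_left inner_diff_right inner_direction inner_commute)
    ultimately have "(m - q) \<bullet> (m - q) = 0"
      using inner_ge_zero[of "m - q"] by linarith
    then have "m - q = 0"
      by (simp only: inner_eq_zero_iff)
    then show ?thesis by (simp add: q_def)
  qed
  define a b where "a = m \<bullet> direction \<alpha>" and "b = m \<bullet> direction \<beta>"
  have "m = a *\<^sub>R direction \<alpha>" "m = b *\<^sub>R direction \<beta>"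
    using fixed sym by (auto simp: a_def b_def)
  then have "a * cos \<alpha> = b * cos \<beta>" "a * sin \<alpha> = b * sin \<beta>"
    by (auto simp: vec_eq_iff forall_2)
  moreover have "a * sin (\<beta> - \<alpha>) = sin \<beta> * (a * cos \<alpha>) - cos \<beta> * (a * sin \<alpha>)"
    by (simp add: sin_diff algebra_simps)
  ultimately have "a * sin (\<beta> - \<alpha>) = 0"
    by (simp add: mult_ac)
  then have "a = 0" using s by simp
  then have "m = 0" using \<open>m = a *\<^sub>R direction \<alpha>\<close> by simp
  then show ?thesis using m(1) by simp
qed

text \<open>Let \<open>p\<close> be the point with coordinates \<open>(a, b)\<close>. Its foot on the mirror along
  \<open>direction \<beta>\<close> is \<open>(0, d)\<close> with \<open>d = a cos (\<alpha> - \<beta>) + b \<ge> b\<close>, because the two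
  directions do not form an obtuse angle. So
  \<open>(0, b)\<close> lies between the origin and the foot, and \<open>(a', b)\<close> lies between \<open>(0, b)\<close> and \<open>p\<close>.\<close>

lemma shrink_first_coordinate:
  assumes K: "convex K" "0 \<in> K" and sym: "reflect_line (direction \<beta>) ` K = K"
    and c: "0 \<le> cos (\<alpha> - \<beta>)"
    and x: "a *\<^sub>R direction \<alpha> + b *\<^sub>R direction \<beta> \<in> K" "0 \<le> b" "0 \<le> a'" "a' \<le> a"
  shows "a' *\<^sub>R direction \<alpha> + b *\<^sub>R direction \<beta> \<in> K"
proof (cases "a = 0")
  case True
  then show ?thesis using x by simp
next
  case False
  then have a: "a > 0" using x by simp
  define d where "d = a * cos (\<alpha> - \<beta>) + b"
  have d: "b \<le> d" "0 \<le> d" using a c x by (simp_all add: d_def)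
  have foot: "d *\<^sub>R direction \<beta> \<in> K"
    using projection_mem[OF K(1) sym x(1)] by (simp add: inner_add_left inner_direction d_def)
  have edge: "b *\<^sub>R direction \<beta> \<in> K"
  proof (cases "d = 0")
    case True
    then show ?thesis using d x K by simp
  next
    case False
    then have "(b / d) *\<^sub>R (d *\<^sub>R direction \<beta>) + (1 - b / d) *\<^sub>R 0 \<in> K"
      using d x by (intro convexD[OF K(1) foot K(2)]) (auto simp: field_simps)
    then show ?thesis using False by simp
  qed
  have "(a' / a) *\<^sub>R (a *\<^sub>R direction \<alpha> + b *\<^sub>R direction \<beta>) + (1 - a' / a) *\<^sub>R (b *\<^sub>R direction \<beta>) \<in> K"
    using a x by (intro convexD[OF K(1) x(1) edge]) (auto simp: field_simps)
  also have "(a' / a) *\<^sub>R (a *\<^sub>R direction \<alpha> + b *\<^sub>R direction \<beta>) + (1 - a' / a) *\<^sub>R (b *\<^sub>R direction \<beta>)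
      = a' *\<^sub>R direction \<alpha> + b *\<^sub>R direction \<beta>"
    using a by (simp add: scaleR_add_right scaleR_diff_left algebra_simps)
  finally show ?thesis .
qed

lemma cone_coords_downward_closed:
  assumes K: "convex K" "0 \<in> K"
    and sym: "reflect_line (direction 0) ` K = K" "reflect_line (direction \<delta>) ` K = K"
    and c: "0 \<le> cos \<delta>"
    and x: "(a, b) \<in> cone_coords \<delta> K" "0 < a'" "a' \<le> a" "0 < b'" "b' \<le> b"
  shows "(a', b') \<in> cone_coords \<delta> K"
proof -
  have ab: "a *\<^sub>R direction 0 + b *\<^sub>R direction \<delta> \<in> K" "0 \<le> b" "0 \<le> a'" "0 \<le> b'"
    using x by (auto simp: cone_coords_def)
  have "a' *\<^sub>R direction 0 + b *\<^sub>R direction \<delta> \<in> K"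
    by (rule shrink_first_coordinate[OF K sym(2) _ ab(1,2,3) x(3)]) (simp add: c)
  then have "b *\<^sub>R direction \<delta> + a' *\<^sub>R direction 0 \<in> K"
    by (simp only: add.commute)
  then have "b' *\<^sub>R direction \<delta> + a' *\<^sub>R direction 0 \<in> K"
    using shrink_first_coordinate[OF K sym(1), of \<delta> b a' b'] ab c x(5) by simp
  then have "a' *\<^sub>R direction 0 + b' *\<^sub>R direction \<delta> \<in> K"
    by (simp only: add.commute)
  then show ?thesis
    using x by (simp add: cone_coords_def)
qed

text \<open>The arithmetic mean of the two points is available by convexity, and the geometric
  mean lies coordinatewise below it.\<close>

lemma cone_coords_geometric_mean:
  assumes K: "convex K" "0 \<in> K"
    and sym: "reflect_line (direction 0) ` K = K" "reflect_line (direction \<delta>) ` K = K"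
    and c: "0 \<le> cos \<delta>" and \<theta>: "0 < \<theta>" "\<theta> < 1"
    and p: "(a, b) \<in> cone_coords \<delta> K" and q: "(a', b') \<in> cone_coords \<delta> K"
  shows "(a powr (1 - \<theta>) * a' powr \<theta>, b powr (1 - \<theta>) * b' powr \<theta>) \<in> cone_coords \<delta> K"
proof (rule cone_coords_downward_closed[OF K sym c])
  have pos: "0 < a" "0 < b" "0 < a'" "0 < b'"
    using p q by (auto simp: cone_coords_def)
  have "(1 - \<theta>) *\<^sub>R (a *\<^sub>R direction 0 + b *\<^sub>R direction \<delta>)
      + \<theta> *\<^sub>R (a' *\<^sub>R direction 0 + b' *\<^sub>R direction \<delta>) \<in> K"
    by (rule convexD[OF K(1)]) (use \<theta> p q in \<open>auto simp: cone_coords_def\<close>)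
  then have "((1 - \<theta>) * a + \<theta> * a') *\<^sub>R direction 0 + ((1 - \<theta>) * b + \<theta> * b') *\<^sub>R direction \<delta> \<in> K"
    by (simp add: algebra_simps)
  then show "((1 - \<theta>) * a + \<theta> * a', (1 - \<theta>) * b + \<theta> * b') \<in> cone_coords \<delta> K"
    using pos \<theta> by (simp add: cone_coords_def add_pos_pos)
  show "a powr (1 - \<theta>) * a' powr \<theta> \<le> (1 - \<theta>) * a + \<theta> * a'"
    "b powr (1 - \<theta>) * b' powr \<theta> \<le> (1 - \<theta>) * b + \<theta> * b'"
    using pos \<theta> by (simp_all add: Youngs_inequality_0)
  show "0 < a powr (1 - \<theta>) * a' powr \<theta>" "0 < b powr (1 - \<theta>) * b' powr \<theta>"
    using pos by simp_all
qed

section \<open>Log-concavity in the dilation parameter\<close>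

lemma mem_scale_iff: "x \<in> (*\<^sub>R) (exp t) ` K \<longleftrightarrow> exp (- t) *\<^sub>R x \<in> K" for K :: "'a::real_vector set"
proof
  assume "exp (- t) *\<^sub>R x \<in> K"
  then show "x \<in> (*\<^sub>R) (exp t) ` K"
    by (intro image_eqI[of _ _ "exp (- t) *\<^sub>R x"]) (simp_all flip: exp_add)
qed (auto simp flip: exp_add)

lemma mem_cone_coords_dilation:
  "(a, b) \<in> cone_coords \<delta> ((*\<^sub>R) (exp t) ` K \<inter> L)
    \<longleftrightarrow> (exp (- t) * a, exp (- t) * b) \<in> cone_coords \<delta> K \<and> (a, b) \<in> cone_coords \<delta> L"
  by (auto simp: cone_coords_def mem_scale_iff scaleR_add_right zero_less_mult_iff)

lemma reflect_line_dilation_Int: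
  assumes "reflect_line u ` K = K" "reflect_line u ` L = L"
  shows "reflect_line u ` ((*\<^sub>R) (exp t) ` K \<inter> L) = (*\<^sub>R) (exp t) ` K \<inter> L"
proof -
  have orth: "orthogonal_transformation (reflect_line u)"
    by (rule orthogonal_transformation_reflect_line)
  have "reflect_line u ` (*\<^sub>R) (exp t) ` K = (*\<^sub>R) (exp t) ` reflect_line u ` K"
    using linear_scale[OF orthogonal_transformation_linear[OF orth]] by (simp add: image_image)
  then show ?thesis
    using assms image_Int[OF orthogonal_transformation_inj[OF orth]] by simp
qed

lemma dihedral_symmetric_reflections:
  assumes "dihedral_symmetric n K"
  shows "reflect_line (direction 0) ` K = K" "reflect_line (direction (pi / n)) ` K = K"
  using assms unfolding dihedral_symmetric_def dihedral_def
  by (auto simp: direction_def dihedral_generators_def intro!: generate.incl)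

theorem theorem3:
  fixes n :: nat and K L :: "(real^2) set"
  assumes "n \<ge> 2"
    and "compact K" "convex K" "interior K \<noteq> {}" "dihedral_symmetric n K"
    and "compact L" "convex L" "interior L \<noteq> {}" "dihedral_symmetric n L"
  shows "(\<forall>t::real. measure lebesgue ((*\<^sub>R) (exp t) ` K \<inter> L) > 0) \<and>
    (\<forall>(s::real) (t::real). \<forall>\<theta>\<in>{0..1}.
       measure lebesgue ((*\<^sub>R) (exp ((1 - \<theta>) * s + \<theta> * t)) ` K \<inter> L)
         \<ge> measure lebesgue ((*\<^sub>R) (exp s) ` K \<inter> L) powr (1 - \<theta>)
           * measure lebesgue ((*\<^sub>R) (exp t) ` K \<inter> L) powr \<theta>)"
proof -
  define \<delta> where "\<delta> = pi / n"
  have \<delta>: "0 < \<delta>" "\<delta> < pi" "\<delta> \<le> pi / 2"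
    using assms(1) by (simp_all add: \<delta>_def field_simps)
  have s: "sin \<delta> > 0" using \<delta> sin_gt_zero by blast
  have c: "0 \<le> cos \<delta>" using \<delta> by (intro cos_ge_zero) auto
  note symK = dihedral_symmetric_reflections[OF assms(5), folded \<delta>_def]
  note symL = dihedral_symmetric_reflections[OF assms(9), folded \<delta>_def]
  have ne: "K \<noteq> {}" "L \<noteq> {}"
    using assms(4,8) interior_subset by auto
  have zero: "0 \<in> K" "0 \<in> L"
    using zero_mem_of_two_reflections[OF assms(3) compact_imp_closed[OF assms(2)] ne(1) symK]
      zero_mem_of_two_reflections[OF assms(7) compact_imp_closed[OF assms(6)] ne(2) symL]
      s by auto
  define S where "S t = (*\<^sub>R) (exp t) ` K \<inter> L" for t :: real
  define M where "M t = measure lborel (cone_coords \<delta> (S t))" for t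
  have S: "compact (S t)" for t
    unfolding S_def using assms by (intro compact_Int compact_scaling)
  have sector: "measure lebesgue A = 2 * n * sin \<delta> * measure lborel (cone_coords \<delta> A)"
    if "compact A" "reflect_line (direction 0) ` A = A" "reflect_line (direction \<delta>) ` A = A" for A
    using measure_eq_fundamental_sector[OF assms(1) lmeasurable_compact[OF that(1)]] that
      cone_coords_regular(3)[OF \<delta>(1,2) that(1)] by (simp add: \<delta>_def)
  have measure_S: "measure lebesgue (S t) = 2 * n * sin \<delta> * M t" for t
    unfolding M_def using S by (rule sector)
      (unfold S_def; intro reflect_line_dilation_Int symK symL)+
  have nonempty: "\<exists>a b. (a, b) \<in> cone_coords \<delta> A"
    if A: "compact A" "convex A" "interior A \<noteq> {}"
      "reflect_line (direction 0) ` A = A" "reflect_line (direction \<delta>) ` A = A" for A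
  proof (rule ccontr)
    assume "\<not> (\<exists>a b. (a, b) \<in> cone_coords \<delta> A)"
    then have "cone_coords \<delta> A = {}" by auto
    then have "measure lebesgue A = 0"
      using sector[OF A(1,4,5)] by simp
    then have "negligible A"
      using lmeasurable_compact[OF A(1)] by (simp add: negligible_iff_measure)
    then show False
      using A(2,3) negligible_convex_interior by blast
  qed
  have pos: "measure lebesgue (S t) > 0" for t
  proof -
    obtain a b where ab: "(a, b) \<in> cone_coords \<delta> K"
      using nonempty[OF assms(2-4) symK] by blast
    obtain a' b' where ab': "(a', b') \<in> cone_coords \<delta> L"
      using nonempty[OF assms(6-8) symL] by blast
    define p q where "p = min (exp t * a) a'" and "q = min (exp t * b) b'"
    have pq: "0 < p" "0 < q"
      using ab ab' by (auto simp: p_def q_def cone_coords_def)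
    \<comment> \<open>Downward closedness puts a whole rectangle at the origin into both coordinate sets.\<close>
    have "{0<..<p} \<times> {0<..<q} \<subseteq> cone_coords \<delta> (S t)"
    proof clarify
      fix x y assume xy: "x \<in> {0<..<p}" "y \<in> {0<..<q}"
      then have K: "exp (- t) * x \<le> a" "exp (- t) * y \<le> b" and L: "x \<le> a'" "y \<le> b'"
        by (auto simp: p_def q_def exp_minus field_simps)
      have "(exp (- t) * x, exp (- t) * y) \<in> cone_coords \<delta> K"
        using xy K by (intro cone_coords_downward_closed[OF assms(3) zero(1) symK c ab]) auto
      moreover have "(x, y) \<in> cone_coords \<delta> L"
        using xy L by (intro cone_coords_downward_closed[OF assms(7) zero(2) symL c ab']) auto
      ultimately show "(x, y) \<in> cone_coords \<delta> (S t)"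
        by (simp add: S_def mem_cone_coords_dilation)
    qed
    moreover have "open ({0<..<p} \<times> {0<..<q})" "{0<..<p} \<times> {0<..<q} \<noteq> {}"
      using pq by (auto intro!: open_Times)
    ultimately have "\<not> negligible (cone_coords \<delta> (S t))"
      using negligible_subset open_not_negligible by blast
    moreover have "cone_coords \<delta> (S t) \<in> lmeasurable"
      using cone_coords_regular(1,2)[OF \<delta>(1,2) S]
      by (intro bounded_set_imp_lmeasurable) (auto simp: sets_completionI_sets)
    ultimately have "measure lebesgue (cone_coords \<delta> (S t)) \<noteq> 0"
      using negligible_iff_measure by blast
    then have "M t > 0"
      using cone_coords_regular(1)[OF \<delta>(1,2) S] by (simp add: M_def zero_less_measure_iff)
    then show ?thesis
      using s assms(1) by (simp add: measure_S)
  qed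
  have ineq: "measure lebesgue (S r) powr (1 - \<theta>) * measure lebesgue (S t) powr \<theta>
      \<le> measure lebesgue (S ((1 - \<theta>) * r + \<theta> * t))" if \<theta>: "0 < \<theta>" "\<theta> < 1" for r t \<theta>
  proof -
    have "M r powr (1 - \<theta>) * M t powr \<theta> \<le> M ((1 - \<theta>) * r + \<theta> * t)"
      unfolding M_def
    proof (rule measure_geometric_mean_set_ge[OF \<theta>])
      fix a b a' b'
      assume p: "(a, b) \<in> cone_coords \<delta> (S r)" and q: "(a', b') \<in> cone_coords \<delta> (S t)"
      \<comment> \<open>Dilations act on the coordinates by scalar factors, which are compatible with geometric means.\<close>
      let ?e = "exp (- ((1 - \<theta>) * r + \<theta> * t))"
      have e: "?e * (x powr (1 - \<theta>) * y powr \<theta>) = (exp (- r) * x) powr (1 - \<theta>) * (exp (- t) * y) powr \<theta>"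
        if "0 < x" "0 < y" for x y
      proof -
        have "?e = exp (- r) powr (1 - \<theta>) * exp (- t) powr \<theta>"
          by (simp add: exp_powr_real algebra_simps flip: exp_add)
        then show ?thesis
          using that by (simp add: powr_mult mult_ac)
      qed
      have pos: "0 < a" "0 < b" "0 < a'" "0 < b'"
        using p q by (auto simp: cone_coords_def)
      show "(a powr (1 - \<theta>) * a' powr \<theta>, b powr (1 - \<theta>) * b' powr \<theta>)
          \<in> cone_coords \<delta> (S ((1 - \<theta>) * r + \<theta> * t))"
        unfolding S_def mem_cone_coords_dilation e[OF pos(1,3)] e[OF pos(2,4)]
        using p q unfolding S_def mem_cone_coords_dilation
        by (blast intro: cone_coords_geometric_mean[OF assms(3) zero(1) symK c \<theta>]
            cone_coords_geometric_mean[OF assms(7) zero(2) symL c \<theta>])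
    qed (use cone_coords_regular[OF \<delta>(1,2) S] in \<open>auto simp: cone_coords_def\<close>)
    then have "2 * n * sin \<delta> * (M r powr (1 - \<theta>) * M t powr \<theta>) \<le> 2 * n * sin \<delta> * M ((1 - \<theta>) * r + \<theta> * t)"
      using s by (intro mult_left_mono) auto
    moreover have "(C * x) powr (1 - \<theta>) * (C * y) powr \<theta> = C * (x powr (1 - \<theta>) * y powr \<theta>)"
      if "0 < C" "0 \<le> x" "0 \<le> y" for C x y :: real
    proof -
      have "(C * x) powr (1 - \<theta>) * (C * y) powr \<theta>
          = (C powr (1 - \<theta>) * C powr \<theta>) * (x powr (1 - \<theta>) * y powr \<theta>)"
        using that by (simp only: powr_mult less_imp_le mult_ac)
      also have "C powr (1 - \<theta>) * C powr \<theta> = C"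
        using that by (simp flip: powr_add)
      finally show ?thesis .
    qed
    ultimately show ?thesis
      unfolding measure_S using s assms(1) by (simp add: M_def)
  qed
  show ?thesis
  proof (intro conjI allI ballI)
    fix r t \<theta> :: real assume "\<theta> \<in> {0..1}"
    \<comment> \<open>At the endpoints the inequality is an equality only because the areas are positive: \<open>0 powr 0 = 0\<close>.\<close>
    then consider "\<theta> = 0" | "\<theta> = 1" | "0 < \<theta>" "\<theta> < 1" by fastforce
    then show "measure lebesgue ((*\<^sub>R) (exp ((1 - \<theta>) * r + \<theta> * t)) ` K \<inter> L)
         \<ge> measure lebesgue ((*\<^sub>R) (exp r) ` K \<inter> L) powr (1 - \<theta>)
           * measure lebesgue ((*\<^sub>R) (exp t) ` K \<inter> L) powr \<theta>"
      using pos ineq[unfolded S_def] by cases (auto simp: S_def less_imp_le)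
  qed (use pos in \<open>simp add: S_def\<close>)
qed

end
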